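(* Let $X$ be a countable, second countable topological space. If $\mathcal{M}(X)\notin\boldsymbol{\Sigma}^0_2(\mathcal{P}(X))$, then $\mathcal{M}(X)$ is $\boldsymbol{\Pi}^0_3$-complete. In particular, $\mathcal{M}(X)$ is not $\boldsymbol{\Delta}^0_3$-sharp.
   Context: "Countable" means countably infinite (the paper writes "at most countable" when finite sets are allowed). For a topological space $X$, a subset $A\subseteq X$ is dense in an open set $U$ if $U\subseteq\overline{A}$, and codense in $U$ if $U\subseteq\overline{X\setminus A}$. A subset $A\subseteq X$ is monitorable if for every non-empty open set $U\subseteq X$ either $A$ is not dense in $U$ or $A$ is not codense in $U$. $\mathcal{M}(X)\subseteq\mathcal{P}(X)$ denotes the family of monitorable subsets of $X$. The powerset $\mathcal{P}(X)$ is identified with $2^X$ via characteristic functions and carries the product topology (with $2=\{0,1\}$ discrete); for countable $X$ it is homeomorphic to the Cantor space. $\boldsymbol{\Sigma}^0_\alpha,\boldsymbol{\Pi}^0_\alpha$ are the usual classes of the Borel hierarchy ($\boldsymbol{\Sigma}^0_1$ = open sets, $\boldsymbol{\Pi}^0_\alpha$ = complements of $\boldsymbol{\Sigma}^0_\alpha$ sets, $\boldsymbol{\Sigma}^0_\alpha$ = at most countable unions of sets in $\bigcup_{\beta<\alpha}\boldsymbol{\Pi}^0_\beta$ for $\alpha\geq 2$), and $\boldsymbol{\Delta}^0_\alpha=\boldsymbol{\Sigma}^0_\alpha\cap\boldsymbol{\Pi}^0_\alpha$. For a boldface pointclass $\boldsymbol{\Gamma}$ and a Polish space $Z$, a set $A\subseteq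 Z$ is $\boldsymbol{\Gamma}$-hard if for every zero-dimensional Polish space $Y$ and every $B\in\boldsymbol{\Gamma}(Y)$ there is a continuous $f:Y\to Z$ with $B=f^{-1}(A)$; $A$ is $\boldsymbol{\Gamma}$-complete if $A\in\boldsymbol{\Gamma}(Z)$ and $A$ is $\boldsymbol{\Gamma}$-hard. For $\alpha\ge2$, $A\subseteq Z$ is $\boldsymbol{\Delta}^0_\alpha$-sharp if $A\in\boldsymbol{\Delta}^0_\alpha(Z)\setminus\bigcup_{\beta<\alpha}(\boldsymbol{\Sigma}^0_\beta(Z)\cup\boldsymbol{\Pi}^0_\beta(Z))$. *)

theory Defs
  imports "HOL-Analysis.Analysis"
begin

section \<open>Monitorable sets\<close>

definition dense_in_open :: "'a topology \<Rightarrow> 'a set \<Rightarrow> 'a set \<Rightarrow> bool" where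
  "dense_in_open X A U \<longleftrightarrow> U \<subseteq> X closure_of A"

definition codense_in_open :: "'a topology \<Rightarrow> 'a set \<Rightarrow> 'a set \<Rightarrow> bool" where
  "codense_in_open X A U \<longleftrightarrow> U \<subseteq> X closure_of (topspace X - A)"

definition monitorable :: "'a topology \<Rightarrow> 'a set \<Rightarrow> bool" where
  "monitorable X A \<longleftrightarrow> A \<subseteq> topspace X \<and>
     (\<forall>U. openin X U \<and> U \<noteq> {} \<longrightarrow> \<not> dense_in_open X A U \<or> \<not> codense_in_open X A U)"

definition monitorable_sets :: "'a topology \<Rightarrow> 'a set set" where
  "monitorable_sets X = {A. monitorable X A}"

section \<open>The powerset as a product space\<close>

text \<open>Library product spaces consist of functions that are \<^const>\<open>undefined\<close> outside the index
  set, hence the restriction of the characteristic function to \<open>S\<close>.\<close>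

definition powerset_topology :: "'a set \<Rightarrow> 'a set topology" where
  "powerset_topology S =
     pullback_topology (Pow S) (\<lambda>A. restrict (\<lambda>x. x \<in> A) S)
       (product_topology (\<lambda>_. discrete_topology (UNIV :: bool set)) S)"

lemma topspace_powerset_topology [simp]: "topspace (powerset_topology S) = Pow S"
  by (auto simp: powerset_topology_def topspace_pullback_topology)

lemma homeomorphic_map_powerset_topology:
  "homeomorphic_map (powerset_topology S)
     (product_topology (\<lambda>_. discrete_topology (UNIV :: bool set)) S)
     (\<lambda>A. restrict (\<lambda>x. x \<in> A) S)"
proof -
  let ?P = "product_topology (\<lambda>_. discrete_topology (UNIV :: bool set)) S"
  let ?f = "\<lambda>A. restrict (\<lambda>x. x \<in> A) S"
  have inj: "inj_on ?f (Pow S)"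
    by (rule inj_onI, auto simp: fun_eq_iff restrict_def) (metis subsetD)+
  have im: "?f ` Pow S = topspace ?P"
  proof (intro equalityI subsetI)
    fix g assume g: "g \<in> topspace ?P"
    then have "g = ?f {x \<in> S. g x}"
      by (auto simp: fun_eq_iff restrict_def PiE_def extensional_def)
    then show "g \<in> ?f ` Pow S" by blast
  qed auto
  have "openin (powerset_topology S) {A \<in> Pow S. ?f A \<in> V} \<longleftrightarrow> openin ?P V"
    if V: "V \<subseteq> topspace ?P" for V
  proof
    assume "openin (powerset_topology S) {A \<in> Pow S. ?f A \<in> V}"
    then obtain W where W: "openin ?P W" "{A \<in> Pow S. ?f A \<in> V} = ?f -` W \<inter> Pow S"
      unfolding powerset_topology_def openin_pullback_topology by blast
    have "?f A \<in> V \<longleftrightarrow> ?f A \<in> W" if "A \<in> Pow S" for A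
      using W(2) that by blast
    moreover have "W \<subseteq> ?f ` Pow S" "V \<subseteq> ?f ` Pow S"
      using openin_subset[OF W(1)] V im by simp_all
    ultimately have "V = W" by blast
    then show "openin ?P V" using W(1) by simp
  next
    assume "openin ?P V"
    then show "openin (powerset_topology S) {A \<in> Pow S. ?f A \<in> V}"
      unfolding powerset_topology_def openin_pullback_topology by blast
  qed
  then show ?thesis
    using inj im by (simp add: homeomorphic_map_def quotient_map_def)
qed

section \<open>Finite levels of the Borel hierarchy\<close>

text \<open>Levels start at 1; \<open>Sigma0 0\<close> and \<open>Pi0 0\<close> are empty by convention.\<close>

fun Sigma0 :: "nat \<Rightarrow> 'z topology \<Rightarrow> 'z set set" where
  "Sigma0 n Z =
     (if n = 0 then {}
      else if n = 1 then {U. openin Z U}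
      else {\<Union>\<C> | \<C>. countable \<C> \<and>
              \<C> \<subseteq> (\<Union>k\<in>{1..<n}. {topspace Z - S | S. S \<in> Sigma0 k Z})})"

declare Sigma0.simps [simp del]

definition Pi0 :: "nat \<Rightarrow> 'z topology \<Rightarrow> 'z set set" where
  "Pi0 n Z = {topspace Z - S | S. S \<in> Sigma0 n Z}"

definition Delta0 :: "nat \<Rightarrow> 'z topology \<Rightarrow> 'z set set" where
  "Delta0 n Z = Sigma0 n Z \<inter> Pi0 n Z"

definition Delta0_sharp :: "nat \<Rightarrow> 'z topology \<Rightarrow> 'z set \<Rightarrow> bool" where
  "Delta0_sharp n Z A \<longleftrightarrow> A \<in> Delta0 n Z - (\<Union>k\<in>{1..<n}. Sigma0 k Z \<union> Pi0 k Z)"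

section \<open>Hardness and completeness\<close>

definition polish_topology :: "'z topology \<Rightarrow> bool" where
  "polish_topology Z \<longleftrightarrow> completely_metrizable_space Z \<and> separable_space Z"

definition zero_dimensional :: "'z topology \<Rightarrow> bool" where
  "zero_dimensional Z \<longleftrightarrow> neighbourhood_base_of (\<lambda>U. closedin Z U \<and> openin Z U) Z"

text \<open>HOL cannot quantify over all types inside a definition, so the type \<open>'y\<close> of the points of
  the test spaces is a parameter: here it is the type argument of the pointclass, and below it is
  passed as \<open>TYPE('y)\<close>. A theorem asserting these properties for a free \<open>'y\<close> covers all
  zero-dimensional Polish spaces.\<close>

definition pointclass_hard ::
  "('y topology \<Rightarrow> 'y set set) \<Rightarrow> 'z topology \<Rightarrow> 'z set \<Rightarrow> bool" where
  "pointclass_hard \<Gamma> Z A \<longleftrightarrow> A \<subseteq> topspace Z \<and>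
     (\<forall>Y B. polish_topology Y \<and> zero_dimensional Y \<and> B \<in> \<Gamma> Y \<longrightarrow>
        (\<exists>f. continuous_map Y Z f \<and> B = {y \<in> topspace Y. f y \<in> A}))"

definition Pi0_complete :: "'y itself \<Rightarrow> nat \<Rightarrow> 'z topology \<Rightarrow> 'z set \<Rightarrow> bool" where
  "Pi0_complete (_ :: 'y itself) n Z A \<longleftrightarrow>
     A \<in> Pi0 n Z \<and> pointclass_hard (Pi0 n :: 'y topology \<Rightarrow> 'y set set) Z A"

end

theory Submission
  imports Defs
begin

text \<open>
  Call a nonempty open set atomless if it contains no minimal nonempty open set, and irreducible if
  any two of its nonempty open subsets meet. A set is monitorable iff every nonempty open set
  contains a nonempty open set on which membership is constant, which is a \<open>\<Pi>\<^sup>0\<^sub>3\<close> condition.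
  If there is no infinite disjoint family of atomless open sets, then finitely many irreducible
  ones meet every atomless open set. Membership then has to be constant on each minimal open set
  (a closed condition) and on some nonempty open part of each of these finitely many sets (an
  \<open>F\<^sub>\<sigma>\<close> condition), so the monitorable sets are \<open>\<Sigma>\<^sup>0\<^sub>2\<close>.

  Otherwise let \<open>S i\<close> be disjoint atomless open sets, and write a \<open>\<Pi>\<^sup>0\<^sub>3\<close> set as the complement of a
  union of \<open>G\<^sub>\<delta>\<close> sets \<open>C i\<close>. Every nonempty open subset of \<open>S i\<close> has infinitely many points that are
  nowhere dense. Given \<open>y\<close>, put such points into \<open>f y\<close>, one in each member of a base of \<open>S i\<close> if
  \<open>y \<in> C i\<close> and only finitely many if \<open>y \<notin> C i\<close>, while reserving another point of each base member to
  stay outside. Then \<open>f y\<close> is dense and codense in \<open>S i\<close> in the first case, and nowhere dense in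
  \<open>S i\<close> in the second.
\<close>

section \<open>Low levels of the Borel hierarchy\<close>

lemma complements_of_open: "{topspace Z - S | S. openin Z S} = Collect (closedin Z)"
  by (auto simp: openin_closedin_eq)
    (metis Diff_Diff_Int closedin_subset inf.absorb_iff2 openin_closedin_eq openin_diff openin_topspace)

lemma Sigma0_1: "Sigma0 (Suc 0) Z = {U. openin Z U}"
  by (simp add: Sigma0.simps)

lemma Sigma0_2: "Sigma0 2 Z = {S. fsigma_in Z S}"
proof -
  note complements_of_open[of Z]
  moreover have "{1..<2} = {Suc 0}" by auto
  ultimately show ?thesis
    by (auto simp: Sigma0.simps[of 2] Sigma0_1 fsigma_in_def union_of_def)
qed

text \<open>Levels 1 and 2 of \<open>Pi0\<close> are the closed and the
  \<open>G\<^sub>\<delta>\<close> sets. Both are listed because a closed set need not be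
  \<open>G\<^sub>\<delta>\<close> in a general space.\<close>

lemma Sigma0_3:
  "Sigma0 3 Z = {\<Union>\<C> |\<C>. countable \<C> \<and> \<C> \<subseteq> {S. closedin Z S \<or> gdelta_in Z S}}"
proof -
  note complements_of_open[of Z]
  moreover have "{topspace Z - S | S. fsigma_in Z S} = Collect (gdelta_in Z)"
    by (auto simp: gdelta_in_fsigma_in double_diff fsigma_in_subset) (metis double_diff subset_refl)
  moreover have "{1..<3} = {Suc 0, 2}" by auto
  ultimately have "(\<Union>k\<in>{1..<3}. {topspace Z - S |S. S \<in> Sigma0 k Z}) = {S. closedin Z S \<or> gdelta_in Z S}"
    using Sigma0_1[of Z] Sigma0_2[of Z] by auto
  then show ?thesis
    by (subst Sigma0.simps) simp
qed

lemma Sigma0_3I: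
  assumes "\<And>n::nat. gdelta_in Z (C n)"
  shows "(\<Union>n. C n) \<in> Sigma0 3 Z"
  unfolding Sigma0_3 using assms by (intro CollectI exI[of _ "range C"]) auto

text \<open>Metrizability makes closed sets \<open>G\<^sub>\<delta>\<close>. Adding
  \<open>{}\<close> to the family makes it nonempty, so that it is the range of a sequence.\<close>

lemma Sigma0_3E:
  assumes "metrizable_space Z" "S \<in> Sigma0 3 Z"
  obtains C :: "nat \<Rightarrow> _" where "\<And>n. gdelta_in Z (C n)" "S = (\<Union>n. C n)"
proof -
  obtain \<C> where \<C>: "countable \<C>" "S = \<Union>\<C>" "\<And>T. T \<in> \<C> \<Longrightarrow> closedin Z T \<or> gdelta_in Z T"
    using assms(2) unfolding Sigma0_3 by blast
  then have g: "gdelta_in Z T" if "T \<in> insert {} \<C>" for T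
    using closed_imp_gdelta_in[OF assms(1)] that by auto
  have r: "range (from_nat_into (insert {} \<C>)) = insert {} \<C>"
    using \<C>(1) by (intro range_from_nat_into) auto
  have "gdelta_in Z (from_nat_into (insert {} \<C>) n)" for n
    by (rule g) (metis r rangeI)
  moreover have "S = (\<Union>n. from_nat_into (insert {} \<C>) n)"
    using \<C>(2) r by simp
  ultimately show ?thesis using that by blast
qed

lemma gdelta_in_preimage:
  assumes f: "continuous_map Y Z f" and S: "gdelta_in Z S"
  shows "gdelta_in Y {y \<in> topspace Y. f y \<in> S}"
proof -
  obtain C where C: "\<And>n::nat. openin Z (C n)" "\<And>n. C (Suc n) \<subseteq> C n" "\<Inter>(range C) = S"
    using S unfolding gdelta_in_descending by metis
  have "\<And>n. openin Y {y \<in> topspace Y. f y \<in> C n}"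
    using f C(1) by (simp add: continuous_map_def)
  moreover have "\<And>n. {y \<in> topspace Y. f y \<in> C (Suc n)} \<subseteq> {y \<in> topspace Y. f y \<in> C n}"
    using C(2) by blast
  moreover have "\<Inter>(range (\<lambda>n. {y \<in> topspace Y. f y \<in> C n})) = {y \<in> topspace Y. f y \<in> S}"
    using C(3) by auto
  ultimately show ?thesis
    unfolding gdelta_in_descending by (intro exI[of _ "\<lambda>n. {y \<in> topspace Y. f y \<in> C n}"]) blast
qed

lemma Sigma0_3_preimage:
  assumes f: "continuous_map Y Z f" and S: "S \<in> Sigma0 3 Z"
  shows "{y \<in> topspace Y. f y \<in> S} \<in> Sigma0 3 Y"
proof -
  obtain \<C> where \<C>: "countable \<C>" "S = \<Union>\<C>" "\<And>T. T \<in> \<C> \<Longrightarrow> closedin Z T \<or> gdelta_in Z T"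
    using S unfolding Sigma0_3 by blast
  let ?D = "(\<lambda>T. {y \<in> topspace Y. f y \<in> T}) ` \<C>"
  have "closedin Y T \<or> gdelta_in Y T" if "T \<in> ?D" for T
    using that \<C>(3) gdelta_in_preimage[OF f] closedin_continuous_map_preimage[OF f] by blast
  moreover have "{y \<in> topspace Y. f y \<in> S} = \<Union>?D" using \<C>(2) by auto
  ultimately show ?thesis unfolding Sigma0_3 using \<C>(1) by blast
qed

section \<open>Clopen partitions in zero-dimensional second countable spaces\<close>

text \<open>The balls of radius \<open>inverse (Suc n)\<close> around the points of a countable
  dense set form a base.\<close>

lemma second_countable_if_separable_metrizable:
  assumes "metrizable_space Y" "separable_space Y"
  shows "second_countable Y"
proof -
  obtain M d where M: "Metric_space M d" and Y: "Y = Metric_space.mtopology M d"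
    using assms(1) unfolding metrizable_space_def by metis
  interpret Metric_space M d by (rule M)
  obtain D where D: "countable D" "D \<subseteq> M" "mtopology closure_of D = M"
    using assms(2) unfolding Y separable_space_def by auto
  let ?B = "(\<lambda>(x,n::nat). mball x (inverse (Suc n))) ` (D \<times> UNIV)"
  show ?thesis
    unfolding second_countable_def Y
  proof (intro exI[of _ ?B] conjI allI impI)
    show "countable ?B" using D(1) by auto
    show "\<forall>V\<in>?B. openin mtopology V" by auto
    fix U x assume U: "openin mtopology U \<and> x \<in> U"
    then have x: "x \<in> M" using openin_mtopology by blast
    obtain r where r: "r > 0" "mball x r \<subseteq> U" using U openin_mtopology by blast
    \<comment> \<open>Half of \<open>r\<close>, because \<open>w\<close> is reached from
      \<open>x\<close> through the centre \<open>z\<close> in two steps, each shorter than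
      \<open>inverse (Suc n)\<close>.\<close>
    obtain n where n: "inverse (Suc n) < r / 2" using reals_Archimedean[of "r/2"] r(1) by auto
    have npos: "inverse (Suc n) > (0::real)" by simp
    have "x \<in> mtopology closure_of D" using D(3) x by simp
    then obtain z where z: "z \<in> D" "z \<in> mball x (inverse (Suc n))"
      unfolding metric_closure_of using npos by blast
    then have zx: "z \<in> M" "d x z < inverse (Suc n)" by auto
    have "x \<in> mball z (inverse (Suc n))" using zx x by (auto simp: commute)
    moreover have "mball z (inverse (Suc n)) \<subseteq> mball x r"
    proof
      fix w assume "w \<in> mball z (inverse (Suc n))"
      then have w: "w \<in> M" "d z w < inverse (Suc n)" by auto
      then have "d x w < r" using zx(2) n triangle[OF x zx(1) w(1)] by linarith
      then show "w \<in> mball x r" using w(1) x by simp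
    qed
    moreover have "mball z (inverse (Suc n)) \<in> ?B"
      by (rule image_eqI[of _ _ "(z, n)"]) (use z(1) in simp_all)
    ultimately show "\<exists>V\<in>?B. x \<in> V \<and> V \<subseteq> U"
      using r(2) by (intro bexI[of _ "mball z (inverse (Suc n))"]) auto
  qed
qed

text \<open>Each basic set that fits into some clopen subset of \<open>U\<close> selects one such
  subset. These countably many clopen sets cover \<open>U\<close>, and subtracting the finitely many
  earlier ones makes them disjoint and keeps them clopen.\<close>

lemma zero_dimensional_open_decomposition:
  assumes "zero_dimensional Y" "second_countable Y" "openin Y U"
  obtains D :: "nat \<Rightarrow> _" where "\<And>n. openin Y (D n)" "\<And>n. closedin Y (D n)"
    "disjoint_family D" "U = (\<Union>n. D n)"
proof -
  obtain \<B> where \<B>: "countable \<B>" "\<And>U x. openin Y U \<Longrightarrow> x \<in> U \<Longrightarrow> \<exists>V\<in>\<B>. x \<in> V \<and> V \<subseteq> U"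
    using assms(2) unfolding second_countable_def by metis
  define Q where "Q b V \<longleftrightarrow> openin Y V \<and> closedin Y V \<and> b \<subseteq> V \<and> V \<subseteq> U" for b V
  define \<B>' where "\<B>' = {b\<in>\<B>. \<exists>V. Q b V}"
  define c where "c b = (SOME V. Q b V)" for b
  have c: "Q b (c b)" if "b \<in> \<B>'" for b
    using that unfolding \<B>'_def c_def by (metis (mono_tags, lifting) mem_Collect_eq someI_ex)
  define \<C> where "\<C> = insert {} (c ` \<B>')"
  have cnt: "countable \<C>" "\<C> \<noteq> {}" using \<B>(1) by (auto simp: \<C>_def \<B>'_def)
  have clop: "openin Y V \<and> closedin Y V \<and> V \<subseteq> U" if "V \<in> \<C>" for V
    using that c unfolding \<C>_def Q_def by auto
  have "U \<subseteq> \<Union>\<C>"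
  proof
    fix x assume x: "x \<in> U"
    obtain W V where V: "openin Y W" "openin Y V" "closedin Y V" "x \<in> W" "W \<subseteq> V" "V \<subseteq> U"
      using assms(1,3) x unfolding zero_dimensional_def neighbourhood_base_of by metis
    obtain b where b: "b \<in> \<B>" "x \<in> b" "b \<subseteq> W" using \<B>(2)[OF V(1) V(4)] by blast
    then have "b \<in> \<B>'" using V unfolding \<B>'_def Q_def by blast
    then show "x \<in> \<Union>\<C>" using c b(2) unfolding \<C>_def Q_def by blast
  qed
  then have U: "U = \<Union>\<C>" using clop by blast
  define K where "K = from_nat_into \<C>"
  have K: "range K = \<C>" unfolding K_def using cnt by (rule range_from_nat_into[rotated])
  have Kn: "openin Y (K n)" "closedin Y (K n)" for n using clop K by blast+
  show ?thesis
  proof (rule that[of "disjointed K"])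
    show "openin Y (disjointed K n)" "closedin Y (disjointed K n)" for n
      unfolding disjointed_def using Kn
      by (auto intro!: openin_diff closedin_diff openin_Union closedin_Union)
    show "U = (\<Union>n. disjointed K n)" using U K UN_disjointed_eq[of K] by simp
  qed (rule disjoint_family_disjointed)
qed

text \<open>The sets \<open>D k n\<close> partition the \<open>k\<close>-th set of a decreasing sequence of open sets with
  intersection \<open>C\<close>.\<close>

lemma gdelta_zero_dimensional_scheme:
  assumes "zero_dimensional Y" "second_countable Y" "gdelta_in Y C"
  obtains D :: "nat \<Rightarrow> nat \<Rightarrow> _" where "\<And>k n. openin Y (D k n)" "\<And>k n. closedin Y (D k n)"
    "\<And>y k. y \<in> C \<Longrightarrow> \<exists>n. y \<in> D k n" "\<And>y. y \<notin> C \<Longrightarrow> finite {(k, n). y \<in> D k n}"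
proof -
  obtain O' where O: "\<And>n. openin Y (O' n)" "\<And>n. O' (Suc n) \<subseteq> O' n" "\<Inter>(range O') = C"
    using assms(3) unfolding gdelta_in_descending by metis
  have "\<exists>D :: nat \<Rightarrow> _. (\<forall>n. openin Y (D n) \<and> closedin Y (D n)) \<and> disjoint_family D \<and> O' k = (\<Union>n. D n)" for k
    using zero_dimensional_open_decomposition[OF assms(1,2) O(1)] by metis
  then obtain D :: "nat \<Rightarrow> nat \<Rightarrow> _" where
    D: "\<And>k n. openin Y (D k n) \<and> closedin Y (D k n)" "\<And>k. disjoint_family (D k)" "\<And>k. O' k = (\<Union>n. D k n)"
    by metis
  show ?thesis
  proof (rule that[of D])
    show "\<exists>n. y \<in> D k n" if "y \<in> C" for y k using that O(3) D(3)[of k] by blast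
    show "finite {(k, n). y \<in> D k n}" if y: "y \<notin> C" for y
    proof -
      \<comment> \<open>Once \<open>y\<close> has left the decreasing sequence at \<open>j\<close>,
        only rows \<open>k < j\<close> can contain it, and each row contains it at most once by
        disjointness.\<close>
      obtain j where j: "y \<notin> O' j" using y O(3) by blast
      have anti: "O' m \<subseteq> O' j" if "j \<le> m" for m
        using O(2) lift_Suc_antimono_le[of O' j m] that by blast
      have lt: "k < j" if "y \<in> D k n" for k n
        using anti[of k] j D(3)[of k] that by (metis UN_I UNIV_I leI subsetD)
      have "n = n'" if "y \<in> D k n" "y \<in> D k n'" for k n n'
        using D(2)[of k] that unfolding disjoint_family_on_def by blast
      then have "inj_on fst {(k, n). y \<in> D k n}" by (auto intro!: inj_onI)
      moreover have "finite (fst ` {(k, n). y \<in> D k n})"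
        by (rule finite_subset[of _ "{..<j}"]) (auto intro: lt)
      ultimately show ?thesis by (rule finite_imageD[rotated])
    qed
  qed (use D in auto)
qed

section \<open>A diagonal set in the Baire space\<close>

text \<open>Boxes constraining finitely many coordinates are clopen, since every subset of the
  discrete factor \<open>nat\<close> is clopen.\<close>

lemma zero_dimensional_baire_space: "zero_dimensional (euclidean :: (nat \<Rightarrow> nat) topology)"
  unfolding zero_dimensional_def neighbourhood_base_of
proof (intro allI impI)
  fix W :: "(nat \<Rightarrow> nat) set" and x assume W: "openin euclidean W \<and> x \<in> W"
  have E: "(euclidean :: (nat \<Rightarrow> nat) topology) = product_topology (\<lambda>_. euclidean) UNIV"
    by (rule euclidean_product_topology[symmetric])
  obtain U where U: "finite {i \<in> UNIV. U i \<noteq> topspace (euclidean :: nat topology)}"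
      "x \<in> Pi\<^sub>E UNIV U" "Pi\<^sub>E UNIV U \<subseteq> W"
    using W unfolding E openin_product_topology_alt by blast
  have "openin euclidean (Pi\<^sub>E UNIV U)"
    unfolding E openin_PiE_gen using U(1) by (auto simp: open_discrete)
  moreover have "closedin euclidean (Pi\<^sub>E UNIV U)"
    unfolding E closedin_product_topology by (simp add: closed_def open_discrete)
  ultimately show "\<exists>U V. openin euclidean U \<and> (closedin euclidean V \<and> openin euclidean V) \<and> x \<in> U \<and> U \<subseteq> V \<and> V \<subseteq> W"
    using U(2,3) by blast
qed

lemma polish_baire_space: "polish_topology (euclidean :: (nat \<Rightarrow> nat) topology)"
proof -
  have "(euclidean :: nat topology) = discrete_topology UNIV"
    by (simp add: topology_eq open_discrete)
  then have "completely_metrizable_space (euclidean :: nat topology)"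
    by (simp add: completely_metrizable_space_discrete_topology)
  then have "completely_metrizable_space (product_topology (\<lambda>_ :: nat. euclidean :: nat topology) UNIV)"
    by (simp add: completely_metrizable_space_product_topology)
  then have "completely_metrizable_space (euclidean :: (nat \<Rightarrow> nat) topology)"
    by (simp add: euclidean_product_topology)
  moreover have "second_countable (euclidean :: (nat \<Rightarrow> nat) topology)"
  proof -
    obtain B :: "(nat \<Rightarrow> nat) set set" where "countable B" "topological_basis B"
      using ex_countable_basis by blast
    then show ?thesis unfolding second_countable_def
      by (intro exI[of _ B]) (auto simp: topological_basis_open elim!: topological_basisE)
  qed
  ultimately show ?thesis
    by (simp add: polish_topology_def second_countable_imp_separable_space)
qed

text \<open>Diagonalisation: points of the Baire space code \<open>\<Sigma>\<^sup>0\<^sub>3\<close>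
  sets, and the points outside the set that they code themselves form a
  \<open>\<Pi>\<^sup>0\<^sub>3\<close> set without a code.\<close>

lemma exists_Pi0_3_not_Sigma0_3:
  obtains D :: "(nat \<Rightarrow> nat) set" where "D \<in> Pi0 3 euclidean" "D \<notin> Sigma0 3 euclidean"
proof -
  let ?Y = "euclidean :: (nat \<Rightarrow> nat) topology"
  obtain B :: "(nat \<Rightarrow> nat) set set" where B: "countable B" "topological_basis B"
    using ex_countable_basis by blast
  \<comment> \<open>The value \<open>{}\<close> pads unions, so that the empty set is also a union
    of a sequence of sets \<open>b i\<close>.\<close>
  define b where "b = from_nat_into (insert {} B)"
  have rb: "range b = insert {} B" unfolding b_def using B(1) by (intro range_from_nat_into) auto
  have ob: "open (b i)" for i
    using rb topological_basis_open[OF B(2)] by (metis insertE open_empty rangeI)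
  have cover: "\<exists>s::nat \<Rightarrow> nat. U = (\<Union>k. b (s k))" if U: "open U" for U
  proof -
    obtain B' where B': "B' \<subseteq> B" "\<Union>B' = U" using B(2) U unfolding topological_basis_def by blast
    let ?I = "insert {} B'"
    have "countable ?I" using B' B(1) countable_subset by auto
    then have r: "range (from_nat_into ?I) = ?I" by (intro range_from_nat_into) auto
    have "\<exists>i. b i = from_nat_into ?I k" for k
      using r rb B'(1) by (metis (no_types, lifting) insert_iff imageE rangeI subset_iff)
    then obtain s where "\<And>k. b (s k) = from_nat_into ?I k" by metis
    then have "(\<Union>k. b (s k)) = \<Union>(range (from_nat_into ?I))" by simp
    also have "\<dots> = U" using r B'(2) by simp
    finally show ?thesis by blast
  qed
  let ?e = "\<lambda>n m k. prod_encode (n, prod_encode (m, k))"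
  \<comment> \<open>Every \<open>\<Sigma>\<^sup>0\<^sub>3\<close> set is \<open>{y. \<exists>n. \<forall>m. \<exists>k. y \<in> b (c (?e n m k))}\<close> for some code \<open>c\<close>; take the code
    to be the point itself.\<close>
  define G where "G n = {y. \<forall>m. \<exists>k. y \<in> b (y (?e n m k))}" for n
  have op: "open {y :: nat \<Rightarrow> nat. y \<in> b (y i)}" for i
  proof -
    \<comment> \<open>Splitting by the value \<open>j\<close> of the coordinate \<open>y i\<close>
      removes the self-reference.\<close>
    have "{y :: nat \<Rightarrow> nat. y \<in> b (y i)} = (\<Union>j. b j \<inter> (\<lambda>y. y i) -` {j})" by auto
    moreover have "open ((\<lambda>y :: nat \<Rightarrow> nat. y i) -` {j})" for j
      by (intro open_vimage open_discrete) (simp add: continuous_on_product_coordinates)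
    ultimately show ?thesis using ob by (simp add: open_UN open_Int)
  qed
  have G: "gdelta_in ?Y (G n)" for n
  proof -
    have "G n = \<Inter>(range (\<lambda>m. \<Union>k. {y. y \<in> b (y (?e n m k))}))" unfolding G_def by auto
    moreover have "gdelta_in ?Y (\<Inter>(range (\<lambda>m. \<Union>k. {y. y \<in> b (y (?e n m k))})))"
      using op by (intro gdelta_in_Inter) (auto intro!: open_imp_gdelta_in open_UN)
    ultimately show ?thesis by simp
  qed
  have "- (\<Union>n. G n) \<in> Pi0 3 ?Y"
    unfolding Pi0_def using Sigma0_3I[of ?Y G] G by (auto simp: Compl_eq_Diff_UNIV)
  moreover have "- (\<Union>n. G n) \<notin> Sigma0 3 ?Y"
  proof
    assume *: "- (\<Union>n. G n) \<in> Sigma0 3 ?Y"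
    have "metrizable_space ?Y"
      using polish_baire_space completely_metrizable_imp_metrizable_space polish_topology_def by blast
    then obtain C :: "nat \<Rightarrow> _" where C: "\<And>n. gdelta_in ?Y (C n)" "- (\<Union>n. G n) = (\<Union>n. C n)"
      using Sigma0_3E[OF _ *] by metis
    have "\<exists>O'. (\<forall>m::nat. open (O' m)) \<and> \<Inter>(range O') = C n" for n
      using C(1)[of n] unfolding gdelta_in_descending by (metis open_openin)
    then obtain O' where O: "\<And>n m::nat. open (O' n m)" "\<And>n. \<Inter>(range (O' n)) = C n" by metis
    have "\<exists>s::nat \<Rightarrow> nat. O' n m = (\<Union>k. b (s k))" for n m using cover O(1) by blast
    then obtain s :: "nat \<Rightarrow> nat \<Rightarrow> nat \<Rightarrow> nat" where s: "\<And>n m. O' n m = (\<Union>k. b (s n m k))" by metis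
    \<comment> \<open>A code of the supposed \<open>\<Sigma>\<^sup>0\<^sub>3\<close> set; evaluating
      the diagonal set at \<open>c\<close> gives the contradiction.\<close>
    define c where "c i = (case prod_decode i of (n, j) \<Rightarrow> case prod_decode j of (m, k) \<Rightarrow> s n m k)" for i
    have c: "c (?e n m k) = s n m k" for n m k by (simp add: c_def)
    have "c \<in> G n \<longleftrightarrow> c \<in> C n" for n
      unfolding G_def O(2)[symmetric] using c s by auto
    then show False using C(2) by blast
  qed
  ultimately show ?thesis using that by blast
qed

text \<open>Hardness reduces the diagonal set to \<open>A\<close>; if \<open>A\<close> were
  \<open>\<Sigma>\<^sup>0\<^sub>3\<close>, so would be its continuous preimage.\<close>

lemma not_Sigma0_3_if_Pi0_3_hard:
  assumes "pointclass_hard (Pi0 3 :: (nat \<Rightarrow> nat) topology \<Rightarrow> _) Z A"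
  shows "A \<notin> Sigma0 3 Z"
proof
  assume A: "A \<in> Sigma0 3 Z"
  obtain D :: "(nat \<Rightarrow> nat) set" where D: "D \<in> Pi0 3 euclidean" "D \<notin> Sigma0 3 euclidean"
    using exists_Pi0_3_not_Sigma0_3 .
  obtain f where "continuous_map euclidean Z f" "D = {y \<in> topspace euclidean. f y \<in> A}"
    using assms D(1) polish_baire_space zero_dimensional_baire_space
    unfolding pointclass_hard_def by meson
  then show False using Sigma0_3_preimage[OF _ A] D(2) by metis
qed

section \<open>Atomless and irreducible open sets\<close>

definition minimal_open :: "'a topology \<Rightarrow> 'a set \<Rightarrow> bool" where
  "minimal_open X V \<longleftrightarrow> openin X V \<and> V \<noteq> {} \<and> (\<forall>W. openin X W \<and> W \<noteq> {} \<and> W \<subseteq> V \<longrightarrow> W = V)"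

definition atomless_open :: "'a topology \<Rightarrow> 'a set \<Rightarrow> bool" where
  "atomless_open X U \<longleftrightarrow> openin X U \<and> U \<noteq> {} \<and> (\<forall>V. minimal_open X V \<longrightarrow> \<not> V \<subseteq> U)"

text \<open>Equivalently, every nonempty open subset of \<open>U\<close> is dense in
  \<open>U\<close>.\<close>

definition irreducible_open :: "'a topology \<Rightarrow> 'a set \<Rightarrow> bool" where
  "irreducible_open X U \<longleftrightarrow> openin X U \<and> U \<noteq> {} \<and>
     (\<forall>V W. openin X V \<and> V \<noteq> {} \<and> V \<subseteq> U \<and> openin X W \<and> W \<noteq> {} \<and> W \<subseteq> U \<longrightarrow> V \<inter> W \<noteq> {})"

text \<open>The usual notion, that the closure has empty interior, in the form in which open sets
  are shrunk below.\<close>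

definition nowhere_dense_in :: "'a topology \<Rightarrow> 'a set \<Rightarrow> bool" where
  "nowhere_dense_in X F \<longleftrightarrow>
     (\<forall>V. openin X V \<and> V \<noteq> {} \<longrightarrow> (\<exists>W. openin X W \<and> W \<noteq> {} \<and> W \<subseteq> V \<and> W \<inter> F = {}))"

lemma atomless_open_mono:
  "atomless_open X U \<Longrightarrow> openin X V \<Longrightarrow> V \<noteq> {} \<Longrightarrow> V \<subseteq> U \<Longrightarrow> atomless_open X V"
  unfolding atomless_open_def by blast

text \<open>Failure of density in \<open>U\<close> yields an open part of \<open>U\<close> missing
  \<open>A\<close>; failure of codensity yields one inside \<open>A\<close>.\<close>

lemma monitorable_iff:
  "monitorable X A \<longleftrightarrow> A \<subseteq> topspace X \<and>
     (\<forall>U. openin X U \<and> U \<noteq> {} \<longrightarrow> (\<exists>V. openin X V \<and> V \<noteq> {} \<and> V \<subseteq> U \<and> (V \<inter> A = {} \<or> V \<subseteq> A)))"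
proof -
  have *: "\<not> U \<subseteq> X closure_of B \<longleftrightarrow> (\<exists>V. openin X V \<and> V \<noteq> {} \<and> V \<subseteq> U \<and> V \<inter> B = {})"
    if U: "openin X U" for U B
  proof
    assume "\<not> U \<subseteq> X closure_of B"
    then obtain x T where "x \<in> U" "x \<in> T" "openin X T" "T \<inter> B = {}"
      using openin_subset[OF U] unfolding closure_of_def by blast
    then show "\<exists>V. openin X V \<and> V \<noteq> {} \<and> V \<subseteq> U \<and> V \<inter> B = {}"
      using U by (intro exI[of _ "U \<inter> T"]) auto
  next
    assume "\<exists>V. openin X V \<and> V \<noteq> {} \<and> V \<subseteq> U \<and> V \<inter> B = {}"
    then show "\<not> U \<subseteq> X closure_of B" unfolding closure_of_def by blast
  qed
  have sub: "V \<inter> (topspace X - A) = {} \<longleftrightarrow> V \<subseteq> A" if "openin X V" for V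
    using openin_subset[OF that] by blast
  have inside: "(\<exists>V. openin X V \<and> V \<noteq> {} \<and> V \<subseteq> U \<and> V \<inter> (topspace X - A) = {}) \<longleftrightarrow>
      (\<exists>V. openin X V \<and> V \<noteq> {} \<and> V \<subseteq> U \<and> V \<subseteq> A)" for U
    by (intro ex_cong1 conj_cong refl) (rule sub)
  have "\<not> U \<subseteq> X closure_of A \<or> \<not> U \<subseteq> X closure_of (topspace X - A) \<longleftrightarrow>
      (\<exists>V. openin X V \<and> V \<noteq> {} \<and> V \<subseteq> U \<and> (V \<inter> A = {} \<or> V \<subseteq> A))" if U: "openin X U" for U
    unfolding *[OF U] inside[of U] by (simp only: conj_disj_distribL ex_disj_distrib)
  then show ?thesis
    unfolding monitorable_def dense_in_open_def codense_in_open_def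
    by (intro conj_cong refl all_cong1 imp_cong) (elim conjE)
qed

lemma finite_nowhere_dense_in:
  assumes "finite F" "\<And>x. x \<in> F \<Longrightarrow> nowhere_dense_in X {x}"
  shows "nowhere_dense_in X F"
  using assms
proof (induction F)
  case empty
  then show ?case unfolding nowhere_dense_in_def by auto
next
  case (insert x F)
  then have F: "nowhere_dense_in X F" and x: "nowhere_dense_in X {x}" by auto
  show ?case
    unfolding nowhere_dense_in_def
  proof (intro allI impI)
    fix V assume "openin X V \<and> V \<noteq> {}"
    then obtain W where W: "openin X W" "W \<noteq> {}" "W \<subseteq> V" "W \<inter> F = {}"
      using F unfolding nowhere_dense_in_def by meson
    then obtain W' where "openin X W'" "W' \<noteq> {}" "W' \<subseteq> W" "W' \<inter> {x} = {}"
      using x unfolding nowhere_dense_in_def by meson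
    then show "\<exists>W. openin X W \<and> W \<noteq> {} \<and> W \<subseteq> V \<and> W \<inter> insert x F = {}"
      using W by (intro exI[of _ W']) auto
  qed
qed

lemma atomless_open_obtains_nowhere_dense_point:
  assumes V: "atomless_open X V"
  obtains x where "x \<in> V" "nowhere_dense_in X {x}"
proof -
  \<comment> \<open>If no point of \<open>V\<close> is nowhere dense, each has an open neighbourhood \<open>I x\<close> in which it is
    generic. A point \<open>y\<close> of \<open>I x\<close> missed by some open \<open>W \<subseteq> I x\<close> cannot have such a neighbourhood.\<close>
  have False if none: "\<And>x. x \<in> V \<Longrightarrow> \<not> nowhere_dense_in X {x}"
  proof -
    have "\<exists>I. openin X I \<and> x \<in> I \<and> (\<forall>W. openin X W \<and> W \<noteq> {} \<and> W \<subseteq> I \<longrightarrow> x \<in> W)" if "x \<in> V" for x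
      using none[OF that] unfolding nowhere_dense_in_def by blast
    then obtain I where I: "\<And>x. x \<in> V \<Longrightarrow> openin X (I x)" "\<And>x. x \<in> V \<Longrightarrow> x \<in> I x"
      "\<And>x W. x \<in> V \<Longrightarrow> openin X W \<Longrightarrow> W \<noteq> {} \<Longrightarrow> W \<subseteq> I x \<Longrightarrow> x \<in> W" by metis
    have oV: "openin X V" using V by (simp add: atomless_open_def)
    obtain x where x: "x \<in> V" using V by (auto simp: atomless_open_def)
    have "\<not> minimal_open X (I x \<inter> V)" using V by (auto simp: atomless_open_def)
    then obtain W where W: "openin X W" "W \<noteq> {}" "W \<subseteq> I x \<inter> V" "W \<noteq> I x \<inter> V"
      using I(1,2)[OF x] oV x unfolding minimal_open_def by blast
    then obtain y where y: "y \<in> I x" "y \<in> V" "y \<notin> W" by blast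
    \<comment> \<open>\<open>I y\<close> meets \<open>I x\<close> in \<open>y\<close>, so genericity
      of \<open>x\<close> puts \<open>x\<close> into \<open>I y\<close>. Then \<open>W\<close> meets
      \<open>I y\<close> in \<open>x\<close>, and genericity of \<open>y\<close> puts
      \<open>y\<close> into \<open>W\<close>.\<close>
    have "x \<in> I y \<inter> I x"
      using I(3)[OF x, of "I y \<inter> I x"] I(1,2)[OF x] I(1,2)[OF y(2)] y(1) by blast
    moreover have "x \<in> W" using I(3)[OF x W(1,2)] W(3) by blast
    ultimately have "y \<in> I y \<inter> W"
      using I(3)[OF y(2), of "I y \<inter> W"] I(1)[OF y(2)] W(1) by blast
    then show False using y(3) by blast
  qed
  then show ?thesis using that by blast
qed

text \<open>If there were only finitely many, some nonempty open part of \<open>V\<close> would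
  avoid them all; but that part is atomless and so contains another such point.\<close>

lemma infinite_nowhere_dense_points:
  assumes V: "atomless_open X V"
  shows "infinite {x \<in> V. nowhere_dense_in X {x}}" (is "infinite ?G")
proof
  assume fin: "finite ?G"
  then have "nowhere_dense_in X ?G" by (rule finite_nowhere_dense_in) auto
  then obtain W where W: "openin X W" "W \<noteq> {}" "W \<subseteq> V" "W \<inter> ?G = {}"
    using V unfolding nowhere_dense_in_def atomless_open_def by meson
  then obtain x where "x \<in> W" "nowhere_dense_in X {x}"
    using atomless_open_obtains_nowhere_dense_point atomless_open_mono[OF V] by meson
  then show False using W by blast
qed

text \<open>Course-of-values recursion along an enumeration of the index type: each new point avoids
  the finitely many earlier ones.\<close>

lemma infinite_sets_injective_choice:
  fixes S :: "'i :: countable \<Rightarrow> 'a set"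
  assumes "\<And>i. infinite (S i)"
  obtains p where "inj p" "\<And>i. p i \<in> S i"
proof -
  let ?T = "\<lambda>n. S (from_nat n)"
  have "\<exists>f :: nat \<Rightarrow> 'a. \<forall>n. f n \<in> ?T n \<and> f n \<notin> f ` {..<n}"
  proof -
    define f where "f = wfrec less_than (\<lambda>f n. SOME x. x \<in> ?T n \<and> x \<notin> f ` {..<n})"
    have f: "f n = (SOME x. x \<in> ?T n \<and> x \<notin> f ` {..<n})" for n
    proof -
      have "cut f less_than n ` {..<n} = f ` {..<n}" by (auto simp: cut_def)
      then show ?thesis unfolding f_def by (subst wfrec) (auto simp: f_def)
    qed
    have "\<exists>x. x \<in> ?T n \<and> x \<notin> f ` {..<n}" for n
      using assms by (metis finite_imageI finite_lessThan finite_subset subsetI)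
    from someI_ex[OF this] have "f n \<in> ?T n \<and> f n \<notin> f ` {..<n}" for n
      by (subst (1 2) f) auto
    then show ?thesis by blast
  qed
  then obtain f :: "nat \<Rightarrow> 'a" where f: "\<And>n. f n \<in> ?T n" "\<And>n. f n \<notin> f ` {..<n}" by blast
  have "inj f"
    by (rule injI) (metis f(2) image_eqI lessThan_iff linorder_neqE_nat)
  then have "inj (f \<circ> to_nat)" by (intro inj_compose) auto
  moreover have "(f \<circ> to_nat) i \<in> S i" for i using f(1)[of "to_nat i"] by simp
  ultimately show ?thesis using that by blast
qed

section \<open>Complexity of the monitorable sets\<close>

lemma openin_powerset_topology_mem:
  assumes "x \<in> S"
  shows "openin (powerset_topology S) {A. A \<subseteq> S \<and> x \<in> A}"
    and "openin (powerset_topology S) {A. A \<subseteq> S \<and> x \<notin> A}"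
proof -
  let ?P = "product_topology (\<lambda>_. discrete_topology (UNIV :: bool set)) S"
  have op: "openin ?P {g \<in> topspace ?P. g x \<in> B}" for B
    by (rule openin_continuous_map_preimage[OF continuous_map_product_projection[OF assms]]) auto
  have pre: "openin (powerset_topology S) ((\<lambda>A. restrict (\<lambda>x. x \<in> A) S) -` {g \<in> topspace ?P. g x \<in> B} \<inter> Pow S)" for B
    unfolding powerset_topology_def openin_pullback_topology using op[of B] by blast
  have "{A. A \<subseteq> S \<and> x \<in> A} = (\<lambda>A. restrict (\<lambda>x. x \<in> A) S) -` {g \<in> topspace ?P. g x \<in> {True}} \<inter> Pow S"
    "{A. A \<subseteq> S \<and> x \<notin> A} = (\<lambda>A. restrict (\<lambda>x. x \<in> A) S) -` {g \<in> topspace ?P. g x \<in> {False}} \<inter> Pow S"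
    using assms by auto
  then show "openin (powerset_topology S) {A. A \<subseteq> S \<and> x \<in> A}"
    "openin (powerset_topology S) {A. A \<subseteq> S \<and> x \<notin> A}"
    using pre[of "{True}"] pre[of "{False}"] by simp_all
qed

lemma closedin_powerset_topology_superset:
  assumes "V \<subseteq> S"
  shows "closedin (powerset_topology S) {A. A \<subseteq> S \<and> V \<subseteq> A}"
proof -
  have "openin (powerset_topology S) (\<Union>x\<in>V. {A. A \<subseteq> S \<and> x \<notin> A})"
    using openin_powerset_topology_mem(2)[of _ S] assms by (intro openin_Union) blast
  moreover have "Pow S - {A. A \<subseteq> S \<and> V \<subseteq> A} = (\<Union>x\<in>V. {A. A \<subseteq> S \<and> x \<notin> A})" by auto
  ultimately show ?thesis unfolding closedin_def by auto
qed

lemma closedin_powerset_topology_disjoint: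
  assumes "V \<subseteq> S"
  shows "closedin (powerset_topology S) {A. A \<subseteq> S \<and> V \<inter> A = {}}"
proof -
  have "openin (powerset_topology S) (\<Union>x\<in>V. {A. A \<subseteq> S \<and> x \<in> A})"
    using openin_powerset_topology_mem(1)[of _ S] assms by (intro openin_Union) blast
  moreover have "Pow S - {A. A \<subseteq> S \<and> V \<inter> A = {}} = (\<Union>x\<in>V. {A. A \<subseteq> S \<and> x \<in> A})" by auto
  ultimately show ?thesis unfolding closedin_def by auto
qed

lemma closedin_powerset_topology_decided:
  assumes "V \<subseteq> S"
  shows "closedin (powerset_topology S) {A. A \<subseteq> S \<and> (V \<inter> A = {} \<or> V \<subseteq> A)}"
proof -
  have "{A. A \<subseteq> S \<and> (V \<inter> A = {} \<or> V \<subseteq> A)} = {A. A \<subseteq> S \<and> V \<inter> A = {}} \<union> {A. A \<subseteq> S \<and> V \<subseteq> A}" by blast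
  then show ?thesis
    using closedin_powerset_topology_superset[OF assms] closedin_powerset_topology_disjoint[OF assms]
    by (simp add: closedin_Un)
qed

text \<open>Continuity is tested at each coordinate \<open>x\<close>, and a map into the discrete
  space \<open>bool\<close> is continuous if the preimage of \<open>True\<close> is clopen.\<close>

lemma continuous_map_into_powerset_topology:
  assumes f: "\<And>y. y \<in> topspace Y \<Longrightarrow> f y \<subseteq> S"
    and clopen: "\<And>x. x \<in> S \<Longrightarrow> openin Y {y \<in> topspace Y. x \<in> f y}"
      "\<And>x. x \<in> S \<Longrightarrow> closedin Y {y \<in> topspace Y. x \<in> f y}"
  shows "continuous_map Y (powerset_topology S) f"
  unfolding powerset_topology_def
proof (rule continuous_map_pullback')
  have "continuous_map Y (discrete_topology (UNIV :: bool set)) (\<lambda>y. x \<in> f y)" if x: "x \<in> S" for x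
    unfolding continuous_map_def
  proof (intro conjI allI impI)
    fix U :: "bool set"
    have "{y \<in> topspace Y. (x \<in> f y) \<in> U} =
        (if True \<in> U then {y \<in> topspace Y. x \<in> f y} else {}) \<union>
        (if False \<in> U then topspace Y - {y \<in> topspace Y. x \<in> f y} else {})"
      (is "?l = ?r")
    proof (intro set_eqI)
      show "y \<in> ?l \<longleftrightarrow> y \<in> ?r" for y by (cases "x \<in> f y") auto
    qed
    moreover have "openin Y ?r" using clopen[OF x] by (auto intro!: openin_Un openin_diff)
    ultimately show "openin Y {y \<in> topspace Y. (x \<in> f y) \<in> U}" by simp
  qed auto
  then show "continuous_map Y (product_topology (\<lambda>_. discrete_topology (UNIV :: bool set)) S)
      ((\<lambda>A. \<lambda>x\<in>S. x \<in> A) \<circ> f)"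
    by (auto simp: continuous_map_componentwise)
  show "topspace Y \<subseteq> f -` Pow S" using f by auto
qed

section \<open>The upper bound\<close>

text \<open>\<open>V\<close> may be shrunk to a member of a countable base, and for a fixed
  \<open>V\<close> the condition on \<open>A\<close> is closed.\<close>

lemma fsigma_in_decided:
  assumes "second_countable X" "openin X U"
  shows "fsigma_in (powerset_topology (topspace X))
    {A. A \<subseteq> topspace X \<and> (\<exists>V. openin X V \<and> V \<noteq> {} \<and> V \<subseteq> U \<and> (V \<inter> A = {} \<or> V \<subseteq> A))}"
    (is "fsigma_in ?P ?L")
proof -
  obtain \<B> where \<B>: "countable \<B>" "\<And>V. V \<in> \<B> \<Longrightarrow> openin X V"
      "\<And>U x. openin X U \<Longrightarrow> x \<in> U \<Longrightarrow> \<exists>V\<in>\<B>. x \<in> V \<and> V \<subseteq> U"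
    using assms(1) unfolding second_countable_def by metis
  let ?F = "\<lambda>V. {A. A \<subseteq> topspace X \<and> (V \<inter> A = {} \<or> V \<subseteq> A)}"
  have "?L = \<Union>(?F ` {V \<in> \<B>. V \<noteq> {} \<and> V \<subseteq> U})" (is "_ = ?R")
  proof
    show "?L \<subseteq> ?R"
    proof
      fix A assume "A \<in> ?L"
      then obtain V where V: "A \<subseteq> topspace X" "openin X V" "V \<noteq> {}" "V \<subseteq> U" "V \<inter> A = {} \<or> V \<subseteq> A" by blast
      then obtain x where "x \<in> V" by blast
      then obtain W where "W \<in> \<B>" "x \<in> W" "W \<subseteq> V" using \<B>(3) V(2) by metis
      then show "A \<in> ?R" using V by blast
    qed
    show "?R \<subseteq> ?L" using \<B>(2) by blast
  qed
  moreover have "fsigma_in ?P ?R"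
    using \<B>(1) closed_imp_fsigma_in[OF closedin_powerset_topology_decided[OF openin_subset[OF \<B>(2)]]]
    by (intro fsigma_in_Union) auto
  ultimately show ?thesis by simp
qed

text \<open>It suffices to test \<open>U\<close> in a countable base. Each test is
  \<open>F\<^sub>\<sigma>\<close>, so failing some test is a countable union of
  \<open>G\<^sub>\<delta>\<close> conditions.\<close>

lemma monitorable_sets_Pi0_3:
  assumes "second_countable X"
  shows "monitorable_sets X \<in> Pi0 3 (powerset_topology (topspace X))" (is "_ \<in> Pi0 3 ?P")
proof -
  obtain \<B> where \<B>: "countable \<B>" "\<And>V. V \<in> \<B> \<Longrightarrow> openin X V"
      "\<And>U x. openin X U \<Longrightarrow> x \<in> U \<Longrightarrow> \<exists>V\<in>\<B>. x \<in> V \<and> V \<subseteq> U"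
    using assms(1) unfolding second_countable_def by metis
  define F where "F U = {A. A \<subseteq> topspace X \<and> (\<exists>V. openin X V \<and> V \<noteq> {} \<and> V \<subseteq> U \<and> (V \<inter> A = {} \<or> V \<subseteq> A))}" for U
  let ?C = "(\<lambda>U. topspace ?P - F U) ` (\<B> - {{}})"
  have "gdelta_in ?P T" if "T \<in> ?C" for T
    using that fsigma_in_decided[OF assms \<B>(2)] unfolding F_def
    by (auto intro!: gdelta_in_diff simp del: topspace_powerset_topology)
  then have "\<Union>?C \<in> Sigma0 3 ?P" unfolding Sigma0_3 using \<B>(1) by blast
  moreover have "monitorable_sets X = topspace ?P - \<Union>?C"
  proof
    show "monitorable_sets X \<subseteq> topspace ?P - \<Union>?C"
      unfolding monitorable_sets_def monitorable_iff F_def using \<B>(2) by auto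
    show "topspace ?P - \<Union>?C \<subseteq> monitorable_sets X"
    proof
      fix A assume A: "A \<in> topspace ?P - \<Union>?C"
      have "\<exists>V. openin X V \<and> V \<noteq> {} \<and> V \<subseteq> U \<and> (V \<inter> A = {} \<or> V \<subseteq> A)" if U: "openin X U" "U \<noteq> {}" for U
      proof -
        obtain W where W: "W \<in> \<B>" "W \<noteq> {}" "W \<subseteq> U" using \<B>(3) U by (metis all_not_in_conv)
        then have "A \<in> F W" using A by blast
        then show ?thesis unfolding F_def using W(3) by blast
      qed
      then show "A \<in> monitorable_sets X"
        using A unfolding monitorable_sets_def monitorable_iff by auto
    qed
  qed
  ultimately show ?thesis unfolding Pi0_def by blast
qed

section \<open>Spaces without infinitely many disjoint atomless open sets\<close>

text \<open>Zorn's lemma: a set disjoint from all of \<M> could be added to it.\<close>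

lemma exists_maximal_disjoint_subfamily:
  obtains \<M> where "\<M> \<subseteq> \<U>" "disjoint \<M>"
    "\<And>I. I \<in> \<U> \<Longrightarrow> (\<And>J. J \<in> \<M> \<Longrightarrow> I \<inter> J = {}) \<Longrightarrow> I = {} \<or> I \<in> \<M>"
proof -
  let ?A = "{F. F \<subseteq> \<U> \<and> disjoint F}"
  have "\<exists>M\<in>?A. \<forall>F\<in>?A. M \<subseteq> F \<longrightarrow> F = M"
  proof (rule subset_Zorn')
    fix C assume C: "subset.chain ?A C"
    then have sub: "C \<subseteq> ?A" and tot: "\<And>F G. F \<in> C \<Longrightarrow> G \<in> C \<Longrightarrow> F \<subseteq> G \<or> G \<subseteq> F"
      by (auto simp: subset_chain_def)
    have "disjoint (\<Union>C)"
    proof (rule disjointI)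
      fix a b assume ab: "a \<in> \<Union>C" "b \<in> \<Union>C" "a \<noteq> b"
      then obtain F G where "F \<in> C" "a \<in> F" "G \<in> C" "b \<in> G" by blast
      then obtain H where "H \<in> C" "a \<in> H" "b \<in> H" using tot by blast
      then show "a \<inter> b = {}" using sub ab(3) by (auto dest: disjointD)
    qed
    then show "\<Union>C \<in> ?A" using sub by blast
  qed
  then obtain M where "M \<in> ?A" and mx: "\<forall>F\<in>?A. M \<subseteq> F \<longrightarrow> F = M" by (elim bexE)
  then have M: "M \<subseteq> \<U>" "disjoint M" by simp_all
  show ?thesis
  proof (rule that[OF M])
    fix I assume I: "I \<in> \<U>" "\<And>J. J \<in> M \<Longrightarrow> I \<inter> J = {}"
    have "disjoint (insert I M)" using M(2) I(2) by (auto simp: pairwise_insert disjnt_def Int_commute)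
    then have "insert I M = M" using bspec[OF mx, of "insert I M"] I(1) M(1) by simp blast
    then show "I = {} \<or> I \<in> M" by blast
  qed
qed

text \<open>Otherwise every atomless open subset of \<open>U\<close> splits into two disjoint ones.
  Keeping one half and splitting the other forever produces the excluded infinite family.\<close>

lemma atomless_contains_irreducible:
  assumes few: "\<nexists>S :: nat \<Rightarrow> 'a set. disjoint_family S \<and> (\<forall>i. atomless_open X (S i))"
    and U: "atomless_open X U"
  obtains I where "irreducible_open X I" "I \<subseteq> U"
proof -
  have False if none: "\<And>I. I \<subseteq> U \<Longrightarrow> \<not> irreducible_open X I"
  proof -
    have split: "\<exists>V W. atomless_open X V \<and> atomless_open X W \<and> V \<subseteq> R \<and> W \<subseteq> R \<and> V \<inter> W = {}"
      if R: "atomless_open X R" "R \<subseteq> U" for R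
    proof -
      have "openin X R" "R \<noteq> {}" using R(1) by (auto simp: atomless_open_def)
      then obtain V W where "openin X V" "V \<noteq> {}" "V \<subseteq> R" "openin X W" "W \<noteq> {}" "W \<subseteq> R" "V \<inter> W = {}"
        using none[OF R(2)] unfolding irreducible_open_def by blast
      then show ?thesis using atomless_open_mono[OF R(1)] by blast
    qed
    \<comment> \<open>In a pair, \<open>S\<close> is the piece that is kept and \<open>R\<close> the
      remainder still to be split; \<open>Q\<close> puts the next pair inside the old
      remainder.\<close>
    define P where "P = (\<lambda>(_::nat) (S, R). atomless_open X S \<and> atomless_open X R \<and> S \<inter> R = {} \<and> R \<subseteq> U)"
    define Q where "Q = (\<lambda>(_::nat) (S :: 'a set, R :: 'a set) (S', R'). S' \<subseteq> R \<and> R' \<subseteq> R)"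
    have "\<exists>f. \<forall>n. P n (f n) \<and> Q n (f n) (f (Suc n))"
    proof (rule dependent_nat_choice)
      show "\<exists>x. P 0 x" using split[OF U] unfolding P_def by auto
      show "\<exists>y. P (Suc n) y \<and> Q n x y" if "P n x" for x n
        using that split[of "snd x"] unfolding P_def Q_def by (auto split: prod.splits) blast
    qed
    then obtain f where f: "\<And>n. P n (f n)" "\<And>n. Q n (f n) (f (Suc n))" by blast
    define S where "S n = fst (f n)" for n
    define R where "R n = snd (f n)" for n
    have SR: "atomless_open X (S n)" "S n \<inter> R n = {}" "S (Suc n) \<subseteq> R n" "R (Suc n) \<subseteq> R n" for n
      using f(1)[of n] f(2)[of n] unfolding P_def Q_def S_def R_def by (auto split: prod.splits)
    have anti: "R n \<subseteq> R m" if "m \<le> n" for m n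
      using lift_Suc_antimono_le[of R, OF SR(4) that] .
    have "S m \<inter> S n = {}" if "m < n" for m n
    proof -
      obtain k where k: "n = Suc (m + k)" using less_imp_Suc_add[OF \<open>m < n\<close>] by blast
      have "S n \<subseteq> R m" unfolding k using SR(3)[of "m + k"] anti[of m "m + k"] by simp
      then show ?thesis using SR(2)[of m] by blast
    qed
    then have "disjoint_family S"
      unfolding disjoint_family_on_def by (metis inf_commute linorder_neqE_nat)
    then show False using few SR(1) by blast
  qed
  then show ?thesis using that by blast
qed

lemma monitorable_sets_fsigma:
  assumes sc: "second_countable X"
    and few: "\<nexists>S :: nat \<Rightarrow> 'a set. disjoint_family S \<and> (\<forall>i. atomless_open X (S i))"
  shows "fsigma_in (powerset_topology (topspace X)) (monitorable_sets X)" (is "fsigma_in ?P _")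
proof -
  obtain \<M> where \<M>: "\<M> \<subseteq> {I. irreducible_open X I \<and> atomless_open X I}" "disjoint \<M>"
    and mx: "\<And>I. I \<in> {I. irreducible_open X I \<and> atomless_open X I} \<Longrightarrow>
        (\<And>J. J \<in> \<M> \<Longrightarrow> I \<inter> J = {}) \<Longrightarrow> I = {} \<or> I \<in> \<M>"
    using exists_maximal_disjoint_subfamily by blast
  have fin: "finite \<M>"
  proof (rule ccontr)
    assume "infinite \<M>"
    then obtain f :: "nat \<Rightarrow> 'a set" where f: "inj f" "range f \<subseteq> \<M>"
      using infinite_countable_subset by blast
    then have "disjoint_family f"
      using \<M>(2) unfolding disjoint_family_on_def by (metis UNIV_I disjointD injD range_subsetD)
    then show False using few f(2) \<M>(1) by blast
  qed
  have meets: "\<exists>J\<in>\<M>. U \<inter> J \<noteq> {}" if U: "atomless_open X U" for U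
  proof -
    obtain I where I: "irreducible_open X I" "I \<subseteq> U" using atomless_contains_irreducible[OF few U] .
    then have "atomless_open X I" "I \<noteq> {}" using atomless_open_mono[OF U] unfolding irreducible_open_def by auto
    \<comment> \<open>Either \<open>I\<close> meets a member of \<M>, or maximality makes
      \<open>I\<close> itself a member, which \<open>U\<close> meets.\<close>
    then show ?thesis using mx[of I] I by blast
  qed
  define F where "F U = {A. A \<subseteq> topspace X \<and> (\<exists>V. openin X V \<and> V \<noteq> {} \<and> V \<subseteq> U \<and> (V \<inter> A = {} \<or> V \<subseteq> A))}" for U
  define E where "E V = {A. A \<subseteq> topspace X \<and> (V \<inter> A = {} \<or> V \<subseteq> A)}" for V
  \<comment> \<open>The factor \<open>topspace ?P\<close> covers the empty family, whose
    intersection is \<open>UNIV\<close>.\<close>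
  have "fsigma_in ?P (topspace ?P \<inter> \<Inter>(F ` \<N>))" if "finite \<N>" "\<N> \<subseteq> \<M>" for \<N>
    using that
  proof (induction \<N>)
    case (insert I \<N>)
    have "openin X I" using insert.prems \<M>(1) by (auto simp: irreducible_open_def)
    then have "fsigma_in ?P (F I)" unfolding F_def by (rule fsigma_in_decided[OF sc])
    moreover have "topspace ?P \<inter> \<Inter>(F ` insert I \<N>) = F I \<inter> (topspace ?P \<inter> \<Inter>(F ` \<N>))" by auto
    ultimately show ?case using insert by (simp add: fsigma_in_Int)
  qed (simp del: topspace_powerset_topology)
  then have "fsigma_in ?P (topspace ?P \<inter> \<Inter>(F ` \<M>))" using fin by blast
  moreover have "closedin ?P (\<Inter>(insert (topspace ?P) (E ` {V. minimal_open X V})))"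
  proof (rule closedin_Inter)
    have "closedin ?P (E V)" if "minimal_open X V" for V
      unfolding E_def using that openin_subset
      by (intro closedin_powerset_topology_decided) (auto simp: minimal_open_def)
    then show "closedin ?P T" if "T \<in> insert (topspace ?P) (E ` {V. minimal_open X V})" for T
      using that by (auto simp del: topspace_powerset_topology)
  qed blast
  ultimately have *: "fsigma_in ?P (\<Inter>(insert (topspace ?P) (E ` {V. minimal_open X V})) \<inter> (topspace ?P \<inter> \<Inter>(F ` \<M>)))"
    by (rule fsigma_in_Int[OF closed_imp_fsigma_in, rotated])
  have "monitorable_sets X = \<Inter>(insert (topspace ?P) (E ` {V. minimal_open X V})) \<inter> (topspace ?P \<inter> \<Inter>(F ` \<M>))"
    (is "_ = ?R")
  proof
    show "monitorable_sets X \<subseteq> ?R"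
    proof
      fix A assume "A \<in> monitorable_sets X"
      then have A: "A \<subseteq> topspace X" "\<And>U. openin X U \<Longrightarrow> U \<noteq> {} \<Longrightarrow>
          (\<exists>V. openin X V \<and> V \<noteq> {} \<and> V \<subseteq> U \<and> (V \<inter> A = {} \<or> V \<subseteq> A))"
        unfolding monitorable_sets_def monitorable_iff by auto
      \<comment> \<open>The only nonempty open subset of a minimal \<open>V\<close> is
        \<open>V\<close>, so membership must be constant on \<open>V\<close> itself.\<close>
      have "A \<in> E V" if "minimal_open X V" for V
        using A that unfolding E_def minimal_open_def by (metis (mono_tags, lifting) mem_Collect_eq)
      moreover have "A \<in> F I" if "I \<in> \<M>" for I
      proof -
        have "openin X I" "I \<noteq> {}" using that \<M>(1) by (auto simp: irreducible_open_def)
        then show ?thesis using A unfolding F_def by blast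
      qed
      ultimately show "A \<in> ?R" using A(1) by auto
    qed
    show "?R \<subseteq> monitorable_sets X"
    proof
      fix A assume R: "A \<in> ?R"
      have "\<exists>V. openin X V \<and> V \<noteq> {} \<and> V \<subseteq> U \<and> (V \<inter> A = {} \<or> V \<subseteq> A)" if U: "openin X U" "U \<noteq> {}" for U
      proof (cases "atomless_open X U")
        case False
        then obtain V where V: "minimal_open X V" "V \<subseteq> U" using U unfolding atomless_open_def by blast
        then have "A \<in> E V" using R by blast
        then show ?thesis using V unfolding E_def minimal_open_def by blast
      next
        case True
        then obtain I where I: "I \<in> \<M>" "U \<inter> I \<noteq> {}" using meets by blast
        then have irr: "irreducible_open X I" using \<M>(1) by blast
        have "A \<in> F I" using R I(1) by blast
        then obtain V where V: "openin X V" "V \<noteq> {}" "V \<subseteq> I" "V \<inter> A = {} \<or> V \<subseteq> A"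
          unfolding F_def by blast
        have "openin X (U \<inter> I)" using U(1) irr by (auto simp: irreducible_open_def)
        \<comment> \<open>Membership is constant somewhere in \<open>I\<close>, on \<open>V\<close>;
          irreducibility makes \<open>V\<close> reach into \<open>U\<close>.\<close>
        then have "(U \<inter> I) \<inter> V \<noteq> {}" "openin X ((U \<inter> I) \<inter> V)"
          using irr V I(2) unfolding irreducible_open_def by blast+
        then show ?thesis using V(4) by (intro exI[of _ "(U \<inter> I) \<inter> V"]) blast
      qed
      then show "A \<in> monitorable_sets X"
        using R unfolding monitorable_sets_def monitorable_iff by auto
    qed
  qed
  then show ?thesis using * by simp
qed

text \<open>The nonempty members of a countable base inside \<open>U\<close>, listed as a sequence.
  They form a \<pi>-base of \<open>U\<close>, which is all that density arguments need.\<close>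

lemma open_subbase_sequence:
  assumes "second_countable X" "openin X U" "U \<noteq> {}"
  obtains B :: "nat \<Rightarrow> _" where "\<And>k. openin X (B k)" "\<And>k. B k \<noteq> {}" "\<And>k. B k \<subseteq> U"
    "\<And>V. openin X V \<Longrightarrow> V \<noteq> {} \<Longrightarrow> V \<subseteq> U \<Longrightarrow> \<exists>k. B k \<subseteq> V"
proof -
  obtain \<B> where \<B>: "countable \<B>" "\<And>V. V \<in> \<B> \<Longrightarrow> openin X V"
      "\<And>U x. openin X U \<Longrightarrow> x \<in> U \<Longrightarrow> \<exists>V\<in>\<B>. x \<in> V \<and> V \<subseteq> U"
    using assms(1) unfolding second_countable_def by metis
  define \<C> where "\<C> = {V \<in> \<B>. V \<noteq> {} \<and> V \<subseteq> U}"
  have ex: "\<exists>W\<in>\<C>. W \<subseteq> V" if "openin X V" "V \<noteq> {}" "V \<subseteq> U" for V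
  proof -
    obtain x where "x \<in> V" using \<open>V \<noteq> {}\<close> by blast
    then obtain W where "W \<in> \<B>" "x \<in> W" "W \<subseteq> V" using \<B>(3)[OF \<open>openin X V\<close>] by blast
    then show ?thesis using \<open>V \<subseteq> U\<close> unfolding \<C>_def by blast
  qed
  then have "\<C> \<noteq> {}" using assms(2,3) by blast
  then have r: "range (from_nat_into \<C>) = \<C>"
    using \<B>(1) by (intro range_from_nat_into) (auto simp: \<C>_def)
  have in_C: "from_nat_into \<C> k \<in> \<C>" for k using r by blast
  show ?thesis
  proof (rule that[of "from_nat_into \<C>"])
    show "\<exists>k. from_nat_into \<C> k \<subseteq> V" if "openin X V" "V \<noteq> {}" "V \<subseteq> U" for V
      using ex[OF that] r by (metis (no_types, lifting) imageE)
  qed (use in_C \<B>(2) in \<open>auto simp: \<C>_def\<close>)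
qed

section \<open>Hardness\<close>

text \<open>The clopen set \<open>K i k n\<close> switches the single point
  \<open>p i k (Suc n)\<close> of \<open>B i k\<close> on or off, so the reduction \<open>f\<close>
  is continuous. The question whether \<open>y\<close> lies in \<open>C i\<close> is encoded inside
  \<open>S i\<close> alone.\<close>

lemma Pi0_3_hard_monitorable_sets:
  fixes S :: "nat \<Rightarrow> 'a set"
  assumes sc: "second_countable X" and disj: "disjoint_family S"
    and S: "\<And>i. atomless_open X (S i)"
  shows "pointclass_hard (Pi0 3 :: 'y topology \<Rightarrow> _) (powerset_topology (topspace X)) (monitorable_sets X)"
  unfolding pointclass_hard_def
proof (intro conjI allI impI)
  show "monitorable_sets X \<subseteq> topspace (powerset_topology (topspace X))"
    by (auto simp: monitorable_sets_def monitorable_iff)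
  fix Y :: "'y topology" and D
  assume Y: "polish_topology Y \<and> zero_dimensional Y \<and> D \<in> Pi0 3 Y"
  then have met: "metrizable_space Y" and zd: "zero_dimensional Y"
    by (auto simp: polish_topology_def completely_metrizable_imp_metrizable_space)
  then have scY: "second_countable Y"
    using Y second_countable_if_separable_metrizable by (auto simp: polish_topology_def)
  obtain D' where D': "D' \<in> Sigma0 3 Y" "D = topspace Y - D'" using Y unfolding Pi0_def by blast
  obtain C :: "nat \<Rightarrow> 'y set" where C: "\<And>i. gdelta_in Y (C i)" "D' = (\<Union>i. C i)"
    using Sigma0_3E[OF met D'(1)] by blast
  have "\<exists>K :: nat \<Rightarrow> nat \<Rightarrow> 'y set. (\<forall>k n. openin Y (K k n) \<and> closedin Y (K k n)) \<and>
      (\<forall>y\<in>C i. \<forall>k. \<exists>n. y \<in> K k n) \<and> (\<forall>y. y \<notin> C i \<longrightarrow> finite {(k, n). y \<in> K k n})" for i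
    using gdelta_zero_dimensional_scheme[OF zd scY C(1)[of i]] by metis
  then obtain K :: "nat \<Rightarrow> nat \<Rightarrow> nat \<Rightarrow> 'y set" where
    K: "\<And>i k n. openin Y (K i k n) \<and> closedin Y (K i k n)"
      "\<And>i y k. y \<in> C i \<Longrightarrow> \<exists>n. y \<in> K i k n" "\<And>i y. y \<notin> C i \<Longrightarrow> finite {(k, n). y \<in> K i k n}"
    by metis
  have "\<exists>B :: nat \<Rightarrow> 'a set. (\<forall>k. openin X (B k) \<and> B k \<noteq> {} \<and> B k \<subseteq> S i) \<and>
      (\<forall>V. openin X V \<and> V \<noteq> {} \<and> V \<subseteq> S i \<longrightarrow> (\<exists>k. B k \<subseteq> V))" for i
    using open_subbase_sequence[OF sc, of "S i"] S[of i] unfolding atomless_open_def by metis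
  then obtain B :: "nat \<Rightarrow> nat \<Rightarrow> 'a set" where
    B: "\<And>i k. openin X (B i k) \<and> B i k \<noteq> {} \<and> B i k \<subseteq> S i"
      "\<And>i V. openin X V \<Longrightarrow> V \<noteq> {} \<Longrightarrow> V \<subseteq> S i \<Longrightarrow> \<exists>k. B i k \<subseteq> V"
    by metis
  have inf: "infinite {x \<in> B i k. nowhere_dense_in X {x}}" for i k
    using B(1)[of i k] by (intro infinite_nowhere_dense_points atomless_open_mono[OF S[of i]]) auto
  \<comment> \<open>\<open>T\<close> does not depend on \<open>n\<close>; the injective choice thus
    supplies a separate point of \<open>B i k\<close> for every \<open>n\<close>.\<close>
  define T where "T = (\<lambda>(i, k, n :: nat). {x \<in> B i k. nowhere_dense_in X {x}})"
  have "infinite (T t)" for t using inf by (cases t) (simp add: T_def)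
  then obtain q where q: "inj q" "\<And>t. q t \<in> T t"
    by (rule infinite_sets_injective_choice[of T]) blast
  \<comment> \<open>The points \<open>p i k 0\<close> are the reserved ones.\<close>
  define p where "p i k n = q (i, k, n)" for i k n
  have p_in: "p i k n \<in> B i k" "nowhere_dense_in X {p i k n}" for i k n
    using q(2)[of "(i, k, n)"] unfolding p_def T_def by auto
  have p_eq: "p i k n = p i' k' n' \<longleftrightarrow> i = i' \<and> k = k' \<and> n = n'" for i k n i' k' n'
    unfolding p_def using q(1) by (auto dest: injD)
  have p_S: "p i k n \<in> S i" for i k n using p_in(1) B(1) by blast
  define f where "f y = {p i k (Suc n) | i k n. y \<in> K i k n}" for y
  have f_iff: "p i k (Suc n) \<in> f y \<longleftrightarrow> y \<in> K i k n" and f_0: "p i k 0 \<notin> f y" for i k n y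
    unfolding f_def by (auto simp: p_eq)
  have f_sub: "f y \<subseteq> topspace X" for y
    unfolding f_def using p_in(1) B(1) openin_subset by blast
  have clopen: "openin Y {y \<in> topspace Y. x \<in> f y} \<and> closedin Y {y \<in> topspace Y. x \<in> f y}" for x
  proof (cases "\<exists>i k n. x = p i k (Suc n)")
    case True
    then obtain i k n where x: "x = p i k (Suc n)" by blast
    have "{y \<in> topspace Y. x \<in> f y} = K i k n"
      unfolding x f_iff using K(1) openin_subset by blast
    then show ?thesis using K(1) by simp
  next
    case False
    then have "{y \<in> topspace Y. x \<in> f y} = {}" unfolding f_def by blast
    then show ?thesis by (simp only: openin_empty closedin_empty)
  qed
  have "continuous_map Y (powerset_topology (topspace X)) f"
    using f_sub clopen by (intro continuous_map_into_powerset_topology) auto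
  moreover have "y \<in> D \<longleftrightarrow> f y \<in> monitorable_sets X" if y: "y \<in> topspace Y" for y
  proof
    assume "y \<in> D"
    then have yC: "y \<notin> C i" for i using D'(2) C(2) by blast
    have "\<exists>V. openin X V \<and> V \<noteq> {} \<and> V \<subseteq> U \<and> (V \<inter> f y = {} \<or> V \<subseteq> f y)" if U: "openin X U" "U \<noteq> {}" for U
    proof (cases "\<exists>i. U \<inter> S i \<noteq> {}")
      case False
      \<comment> \<open>All points of \<open>f y\<close> lie in the sets \<open>S i\<close>.\<close>
      then have "U \<inter> f y = {}" unfolding f_def using p_S by blast
      then show ?thesis using U by blast
    next
      case True
      then obtain i where i: "U \<inter> S i \<noteq> {}" by blast
      let ?F = "(\<lambda>(k, n). p i k (Suc n)) ` {(k, n). y \<in> K i k n}"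
      have "nowhere_dense_in X ?F"
      proof (rule finite_nowhere_dense_in)
        show "finite ?F" by (rule finite_imageI[OF K(3)[OF yC]])
        show "nowhere_dense_in X {x}" if "x \<in> ?F" for x using that p_in(2) by auto
      qed
      moreover have "openin X (U \<inter> S i)" using U(1) S[of i] by (auto simp: atomless_open_def)
      ultimately obtain V where V: "openin X V" "V \<noteq> {}" "V \<subseteq> U \<inter> S i" "V \<inter> ?F = {}"
        using i unfolding nowhere_dense_in_def by metis
      \<comment> \<open>By disjointness, points placed for other indices stay outside
        \<open>S i\<close>, so only the finite set \<open>?F\<close> matters there.\<close>
      have "S i \<inter> f y \<subseteq> ?F"
      proof
        fix x assume x: "x \<in> S i \<inter> f y"
        then obtain j k n where j: "x = p j k (Suc n)" "y \<in> K j k n" unfolding f_def by blast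
        have "x \<in> S j" using p_S j(1) by simp
        then have "j = i" using disj x unfolding disjoint_family_on_def by blast
        then show "x \<in> ?F" using j by auto
      qed
      then have "V \<inter> f y = {}" using V(3,4) by blast
      then show ?thesis using V(1-3) by blast
    qed
    then show "f y \<in> monitorable_sets X"
      using f_sub[of y] unfolding monitorable_sets_def monitorable_iff by simp
  next
    assume M: "f y \<in> monitorable_sets X"
    show "y \<in> D"
    proof (rule ccontr)
      assume "y \<notin> D"
      then obtain i where i: "y \<in> C i" using y D'(2) C(2) by blast
      have "openin X (S i)" "S i \<noteq> {}" using S[of i] by (auto simp: atomless_open_def)
      then obtain V where V: "openin X V" "V \<noteq> {}" "V \<subseteq> S i" "V \<inter> f y = {} \<or> V \<subseteq> f y"
        using M unfolding monitorable_sets_def monitorable_iff by blast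
      obtain k where k: "B i k \<subseteq> V" using B(2) V by blast
      obtain n where "y \<in> K i k n" using K(2)[OF i] by blast
      \<comment> \<open>\<open>B i k\<close> holds both a point switched on by \<open>y\<close> and
        the reserved point, so membership is not constant on \<open>V\<close>.\<close>
      then have "p i k (Suc n) \<in> V \<inter> f y" using k p_in(1) f_iff by blast
      moreover have "p i k 0 \<in> V - f y" using k p_in(1) f_0 by blast
      ultimately show False using V(4) by blast
    qed
  qed
  ultimately show "\<exists>f. continuous_map Y (powerset_topology (topspace X)) f \<and>
      D = {y \<in> topspace Y. f y \<in> monitorable_sets X}"
    using D'(2) by (intro exI[of _ f]) blast
qed

text \<open>Not being \<open>\<Sigma>\<^sup>0\<^sub>2\<close> rules out the case of few disjoint
  atomless open sets, and the remaining case is hard.\<close>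

lemma Pi0_3_complete_monitorable_sets:
  fixes X :: "'a topology"
  assumes "second_countable X" "monitorable_sets X \<notin> Sigma0 2 (powerset_topology (topspace X))"
  shows "Pi0_complete TYPE('y) 3 (powerset_topology (topspace X)) (monitorable_sets X)"
proof -
  obtain S :: "nat \<Rightarrow> 'a set" where "disjoint_family S" "\<And>i. atomless_open X (S i)"
    using monitorable_sets_fsigma[OF assms(1)] assms(2) unfolding Sigma0_2 by blast
  then show ?thesis
    unfolding Pi0_complete_def
    using monitorable_sets_Pi0_3[OF assms(1)] Pi0_3_hard_monitorable_sets[OF assms(1)] by blast
qed

theorem corollary3p14:
  fixes X :: "'a topology"
  assumes "countable (topspace X)" and "infinite (topspace X)"
    and "second_countable X"
  shows "(monitorable_sets X \<notin> Sigma0 2 (powerset_topology (topspace X)) \<longrightarrow>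
            Pi0_complete TYPE('y) 3 (powerset_topology (topspace X)) (monitorable_sets X))
         \<and> \<not> Delta0_sharp 3 (powerset_topology (topspace X)) (monitorable_sets X)"
proof (intro conjI impI notI)
  assume "monitorable_sets X \<notin> Sigma0 2 (powerset_topology (topspace X))"
  then show "Pi0_complete TYPE('y) 3 (powerset_topology (topspace X)) (monitorable_sets X)"
    by (rule Pi0_3_complete_monitorable_sets[OF assms(3)])
next
  assume "Delta0_sharp 3 (powerset_topology (topspace X)) (monitorable_sets X)"
  \<comment> \<open>Sharpness itself excludes \<open>\<Sigma>\<^sup>0\<^sub>2\<close>, so
    completeness applies and contradicts \<open>\<Sigma>\<^sup>0\<^sub>3\<close>.\<close>
  then have S3: "monitorable_sets X \<in> Sigma0 3 (powerset_topology (topspace X))"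
    and S2: "monitorable_sets X \<notin> Sigma0 2 (powerset_topology (topspace X))"
    unfolding Delta0_sharp_def Delta0_def by auto
  \<comment> \<open>The test type is \<open>nat \<Rightarrow> nat\<close>, since the diagonal set
    lives in the Baire space.\<close>
  have "Pi0_complete TYPE(nat \<Rightarrow> nat) 3 (powerset_topology (topspace X)) (monitorable_sets X)"
    by (rule Pi0_3_complete_monitorable_sets[OF assms(3) S2])
  then show False
    using not_Sigma0_3_if_Pi0_3_hard S3 unfolding Pi0_complete_def by blast
qed

end
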